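(* Let $(\Omega,\mathcal{B},\mu)$ be any measure space, $p\in[1,\infty]$, and $x\in L_p^{\mathbb{C}}(\mu)\setminus\{0\}$. Then $$\frac{\|\operatorname{Re}x\|_p+\|\operatorname{Im}x\|_p}{\|x\|_p}\le\begin{cases}\sqrt2&\text{if }1\le p\le2,\\ 2^{1-1/p}&\text{if }2\le p<\infty,\\ 2&\text{if }p=\infty.\end{cases}$$ In the first case ($1\le p\le2$) equality holds if $\operatorname{Re}x=\operatorname{Im}x$. In the second and third cases ($2\le p<\infty$ and $p=\infty$) equality holds if $\|\operatorname{Re}x\|_p=\|\operatorname{Im}x\|_p$ and $(\operatorname{Re}x(t))(\operatorname{Im}x(t))=0$ for almost all $t\in\Omega$.
   Context: $L_p^{\mathbb{C}}(\mu)$ is the usual Banach space of $\mathcal{B}$-measurable functions $x:\Omega\to\mathbb{C}$ (identified when equal almost everywhere) with $\|x\|_p<\infty$, where $\|x\|_p=\left(\int_\Omega|x(t)|^p\,d\mu_t\right)^{1/p}$ for $1\le p<\infty$ and $\|x\|_\infty=\operatorname{ess\,sup}_{t\in\Omega}|x(t)|$. $\operatorname{Re}x$ and $\operatorname{Im}x$ are the pointwise real and imaginary parts. *)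

theory Defs
  imports "HOL-Probability.Essential_Supremum"
begin

text \<open>
  Powers of extended nonnegative reals; only used with exponent \<open>r > 0\<close>, where \<open>\<infinity>\<close> to the
  power \<open>r\<close> is \<open>\<infinity>\<close>.
\<close>
definition ennreal_powr :: "ennreal \<Rightarrow> real \<Rightarrow> ennreal" where
  "ennreal_powr a r = (if a = \<infinity> then \<infinity> else ennreal (enn2real a powr r))"

text \<open>
  The value is extended, so that the norm of a measurable function is \<open>\<infinity>\<close> exactly when the
  function is not in \<open>L\<^sub>p\<close>. The codomain is an arbitrary normed space because the norm is applied both to
  complex-valued functions and to their real-valued real and imaginary parts. On a null measure
  space the essential supremum is \<open>bot\<close>, which is \<open>0\<close> in \<^typ>\<open>ennreal\<close>, as it should be.
\<close>
definition Lp_norm :: "'a measure \<Rightarrow> ennreal \<Rightarrow> ('a \<Rightarrow> 'b::real_normed_vector) \<Rightarrow> ennreal" where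
  "Lp_norm M p f =
    (if p = \<infinity> then esssup M (\<lambda>t. ennreal (norm (f t)))
     else ennreal_powr (\<integral>\<^sup>+t. ennreal (norm (f t) powr enn2real p) \<partial>M) (1 / enn2real p))"

text \<open>
  Elements of complex \<open>L\<^sub>p\<close> are given by representatives: equality in \<open>L\<^sub>p\<close> is equality almost
  everywhere.
\<close>
definition Lp_complex :: "'a measure \<Rightarrow> ennreal \<Rightarrow> ('a \<Rightarrow> complex) set" where
  "Lp_complex M p = {x \<in> borel_measurable M. Lp_norm M p x < \<infinity>}"

end

theory Submission
  imports Defs
begin

text \<open>
  Both finite cases have the same proof. Suppose that \<open>\<bar>Re z\<bar>\<^sup>r + \<bar>Im z\<bar>\<^sup>r \<le> K \<bar>z\<bar>\<^sup>r\<close> for all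
  complex \<open>z\<close>, where \<open>r\<close> is the real number \<open>p\<close>. Integration gives \<open>A\<^sup>r + B\<^sup>r \<le> K N\<^sup>r\<close> for the norms
  \<open>A\<close>, \<open>B\<close>, \<open>N\<close> of \<open>Re x\<close>, \<open>Im x\<close>, \<open>x\<close>, and concavity of \<open>s \<mapsto> s powr (1 / r)\<close> gives
  \<open>A + B \<le> 2 powr (1 - 1 / r) * (A\<^sup>r + B\<^sup>r) powr (1 / r)\<close>, so that
  \<open>A + B \<le> 2 powr (1 - 1 / r) * K powr (1 / r) * N\<close> (lemma \<open>Lp_norm_Re_Im_le\<close>).

  To find \<open>K\<close>, write \<open>\<bar>z\<bar>\<^sup>r\<close> as the power \<open>r / 2\<close> of \<open>(Re z)\<^sup>2 + (Im z)\<^sup>2\<close>. If \<open>r \<ge> 2\<close>, the power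
  function with exponent \<open>r / 2\<close> is superadditive and \<open>K = 1\<close>. If \<open>r \<le> 2\<close>, it is concave and
  \<open>K = 2 powr (1 - r / 2)\<close>, for which the powers of two combine to \<open>sqrt 2\<close>. For \<open>p = \<infinity>\<close>, the bound is
  the sum of the pointwise inequalities \<open>\<bar>Re x\<bar> \<le> \<bar>x\<bar>\<close> and \<open>\<bar>Im x\<bar> \<le> \<bar>x\<bar>\<close>.

  The equality cases: if \<open>Re x = Im x\<close>, then \<open>\<bar>x\<bar> = sqrt 2 * \<bar>Re x\<bar>\<close>, so \<open>N = sqrt 2 * A\<close> and
  \<open>A = B\<close>. If the supports of \<open>Re x\<close> and \<open>Im x\<close> are disjoint, then \<open>N\<^sup>r = A\<^sup>r + B\<^sup>r\<close> for finite \<open>p\<close> and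
  \<open>N = max A B\<close> for \<open>p = \<infinity>\<close>; with \<open>A = B\<close> this determines the ratio.
\<close>

section \<open>Sums of real powers\<close>

lemma powr_add_le_concave:
  fixes u v r :: real
  assumes "0 \<le> u" "0 \<le> v" "0 < r" "r \<le> 1"
  shows "u powr r + v powr r \<le> 2 powr (1 - r) * (u + v) powr r"
proof (cases "u = 0 \<or> v = 0")
  case True
  have "1 \<le> (2::real) powr (1 - r)"
    using assms by (simp add: ge_one_powr_ge_zero)
  then have "w powr r \<le> 2 powr (1 - r) * w powr r" for w :: real
    by (simp add: mult_le_cancel_right1)
  then show ?thesis using True assms by auto
next
  case False
  then have uv: "0 < u" "0 < v" using assms by auto
  let ?m = "(u powr r + v powr r) / 2"
  \<comment> \<open>Midpoint convexity of the inverse function \<open>w \<mapsto> w powr (1 / r)\<close>, at the points \<open>u powr r\<close> and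
    \<open>v powr r\<close>.\<close>
  have "convex_on {0<..} (\<lambda>w::real. w powr (1 / r))"
    using assms by (intro powr_convex) auto
  from convex_onD[OF this, of "1/2" "u powr r" "v powr r"]
  have "?m powr (1 / r) \<le> (u + v) / 2"
    using uv assms by (simp add: powr_powr field_simps)
  then have "(?m powr (1 / r)) powr r \<le> ((u + v) / 2) powr r"
    using assms by (intro powr_mono2) auto
  then have "?m \<le> ((u + v) / 2) powr r"
    using uv assms by (simp add: powr_powr)
  then show ?thesis
    using uv by (simp add: powr_divide powr_diff field_simps)
qed

lemma powr_add_ge_superadditive:
  fixes u v q :: real
  assumes "0 \<le> u" "0 \<le> v" "1 \<le> q"
  shows "u powr q + v powr q \<le> (u + v) powr q"
proof -
  have split: "w powr q = w * w powr (q - 1)" if "0 \<le> w" for w :: real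
    using that by (cases "w = 0") (auto simp: powr_diff)
  have "u * u powr (q - 1) \<le> u * (u + v) powr (q - 1)"
       "v * v powr (q - 1) \<le> v * (u + v) powr (q - 1)"
    using assms by (auto intro!: mult_left_mono powr_mono2)
  then show ?thesis
    using assms by (simp add: split distrib_right)
qed

section \<open>Absolute powers of the real and imaginary parts\<close>

lemma abs_powr_eq_square_powr:
  fixes a r :: real
  shows "\<bar>a\<bar> powr r = (a\<^sup>2) powr (r / 2)"
proof (cases "a = 0")
  case False
  then have "a\<^sup>2 = \<bar>a\<bar> powr 2" by simp
  then show ?thesis by (simp only: powr_powr) simp
qed simp

lemma cmod_powr_eq_square_powr:
  "cmod z powr r = ((Re z)\<^sup>2 + (Im z)\<^sup>2) powr (r / 2)"
  using abs_powr_eq_square_powr[of "cmod z" r] by (simp add: cmod_power2)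

lemma abs_Re_Im_powr_le_concave:
  assumes "0 < r" "r \<le> 2"
  shows "\<bar>Re z\<bar> powr r + \<bar>Im z\<bar> powr r \<le> 2 powr (1 - r / 2) * cmod z powr r"
  unfolding abs_powr_eq_square_powr cmod_powr_eq_square_powr
  using assms by (intro powr_add_le_concave) auto

lemma abs_Re_Im_powr_le_superadditive:
  assumes "2 \<le> r"
  shows "\<bar>Re z\<bar> powr r + \<bar>Im z\<bar> powr r \<le> cmod z powr r"
  unfolding abs_powr_eq_square_powr cmod_powr_eq_square_powr
  using assms by (intro powr_add_ge_superadditive) auto

section \<open>Powers of extended nonnegative reals\<close>

lemma ennreal_powr_ennreal:
  "0 \<le> a \<Longrightarrow> ennreal_powr (ennreal a) s = ennreal (a powr s)"
  by (simp add: ennreal_powr_def)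

lemma ennreal_powr_cmult:
  assumes "0 < c"
  shows "ennreal_powr (ennreal c * a) s = ennreal (c powr s) * ennreal_powr a s"
  using assms
  by (cases a) (simp_all add: ennreal_powr_def ennreal_mult_top powr_mult flip: ennreal_mult)

lemma ennreal_powr_eq_infinity_iff: "ennreal_powr a s = \<infinity> \<longleftrightarrow> a = \<infinity>"
  by (simp add: ennreal_powr_def)

lemma ennreal_powr_inject:
  assumes "0 < s"
  shows "ennreal_powr a s = ennreal_powr b s \<longleftrightarrow> a = b"
proof
  assume eq: "ennreal_powr a s = ennreal_powr b s"
  show "a = b"
  proof (cases "a = \<infinity> \<or> b = \<infinity>")
    case True
    then show ?thesis using eq ennreal_powr_eq_infinity_iff by metis
  next
    case False
    then obtain u v where uv: "a = ennreal u" "0 \<le> u" "b = ennreal v" "0 \<le> v"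
      by (cases a; cases b) auto
    then have "u powr s = v powr s" using eq by (simp add: ennreal_powr_ennreal)
    then have "(u powr s) powr (1 / s) = (v powr s) powr (1 / s)" by simp
    then show ?thesis using uv assms by (simp add: powr_powr)
  qed
qed simp

section \<open>Norms for finite exponents\<close>

lemma Lp_norm_finite_exponent:
  "p < \<infinity> \<Longrightarrow> Lp_norm M p f =
    ennreal_powr (\<integral>\<^sup>+t. ennreal (norm (f t) powr enn2real p) \<partial>M) (1 / enn2real p)"
  by (auto simp: Lp_norm_def)

lemma enn2real_ge_one:
  assumes "1 \<le> p" "p < \<infinity>"
  shows "1 \<le> enn2real p"
  using enn2real_mono[of 1 p] assms by simp

lemma Lp_norm_eq_cmult_if_AE:
  fixes f :: "'a \<Rightarrow> 'b::real_normed_vector" and g :: "'a \<Rightarrow> 'c::real_normed_vector"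
  assumes p: "1 \<le> p" "p < \<infinity>" and g: "g \<in> borel_measurable M" and c: "0 < c"
    and eq: "AE t in M. norm (f t) = c * norm (g t)"
  shows "Lp_norm M p f = ennreal c * Lp_norm M p g"
proof -
  define r where "r = enn2real p"
  have r: "1 \<le> r" unfolding r_def using p by (rule enn2real_ge_one)
  have "(\<integral>\<^sup>+t. ennreal (norm (f t) powr r) \<partial>M)
      = (\<integral>\<^sup>+t. ennreal (c powr r) * ennreal (norm (g t) powr r) \<partial>M)"
    using eq c by (intro nn_integral_cong_AE) (auto simp: powr_mult ennreal_mult)
  also have "\<dots> = ennreal (c powr r) * (\<integral>\<^sup>+t. ennreal (norm (g t) powr r) \<partial>M)"
    using g by (intro nn_integral_cmult) measurable
  finally show ?thesis
    using p c r by (simp add: Lp_norm_finite_exponent ennreal_powr_cmult powr_powr flip: r_def)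
qed

lemma Lp_norm_eq_0_imp_AE:
  assumes p: "1 \<le> p" and f: "f \<in> borel_measurable M" and "Lp_norm M p f = 0"
  shows "AE t in M. f t = 0"
proof (cases "p = \<infinity>")
  case True
  then show ?thesis
    using assms esssup_AE[of "\<lambda>t. ennreal (norm (f t))" M] by (simp add: Lp_norm_def)
next
  case False
  define r where "r = enn2real p"
  have fin: "p < \<infinity>" using False by (simp add: less_top)
  have r: "1 \<le> r" unfolding r_def using p fin by (rule enn2real_ge_one)
  have "ennreal_powr (\<integral>\<^sup>+t. ennreal (norm (f t) powr r) \<partial>M) (1 / r) = ennreal_powr 0 (1 / r)"
    using assms fin by (simp add: Lp_norm_finite_exponent r_def ennreal_powr_def)
  then have "(\<integral>\<^sup>+t. ennreal (norm (f t) powr r) \<partial>M) = 0"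
    using r by (simp add: ennreal_powr_inject)
  then show ?thesis
    using f by (subst (asm) nn_integral_0_iff_AE) auto
qed

text \<open>
  The constant is the product of the loss in passing from the pointwise inequality to the norms
  and of the loss in comparing \<open>A + B\<close> with \<open>(A\<^sup>r + B\<^sup>r) powr (1 / r)\<close>. Concavity is applied to the
  integrals \<open>A\<^sup>r\<close> and \<open>B\<^sup>r\<close>, which are finite because the pointwise inequality bounds them.
\<close>
lemma Lp_norm_Re_Im_le:
  fixes x :: "'a \<Rightarrow> complex"
  assumes p: "1 \<le> p" "p < \<infinity>" and x: "x \<in> Lp_complex M p" and K: "0 < K"
    and pointwise: "\<And>z. \<bar>Re z\<bar> powr enn2real p + \<bar>Im z\<bar> powr enn2real p
      \<le> K * cmod z powr enn2real p"
  shows "Lp_norm M p (\<lambda>t. Re (x t)) + Lp_norm M p (\<lambda>t. Im (x t))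
    \<le> ennreal (2 powr (1 - 1 / enn2real p) * K powr (1 / enn2real p)) * Lp_norm M p x"
proof -
  define r where "r = enn2real p"
  have r: "1 \<le> r" unfolding r_def using p by (rule enn2real_ge_one)
  have [measurable]: "x \<in> borel_measurable M" using x by (simp add: Lp_complex_def)
  define I where "I = (\<integral>\<^sup>+t. ennreal (cmod (x t) powr r) \<partial>M)"
  define J where "J = (\<integral>\<^sup>+t. ennreal (\<bar>Re (x t)\<bar> powr r) \<partial>M)"
  define L where "L = (\<integral>\<^sup>+t. ennreal (\<bar>Im (x t)\<bar> powr r) \<partial>M)"
  have norms: "Lp_norm M p x = ennreal_powr I (1 / r)"
    "Lp_norm M p (\<lambda>t. Re (x t)) = ennreal_powr J (1 / r)"
    "Lp_norm M p (\<lambda>t. Im (x t)) = ennreal_powr L (1 / r)"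
    using p by (simp_all add: Lp_norm_finite_exponent I_def J_def L_def r_def)
  have "Lp_norm M p x \<noteq> \<infinity>" using x by (simp add: Lp_complex_def less_top)
  then have "I \<noteq> \<infinity>" unfolding norms using ennreal_powr_eq_infinity_iff by metis
  then obtain i where i: "I = ennreal i" "0 \<le> i" by (cases I) auto
  have "J + L = (\<integral>\<^sup>+t. ennreal (\<bar>Re (x t)\<bar> powr r) + ennreal (\<bar>Im (x t)\<bar> powr r) \<partial>M)"
    unfolding J_def L_def by (rule nn_integral_add[symmetric]) measurable
  also have "\<dots> \<le> (\<integral>\<^sup>+t. ennreal K * ennreal (cmod (x t) powr r) \<partial>M)"
    using pointwise K
    by (intro nn_integral_mono) (simp add: r_def flip: ennreal_plus ennreal_mult)
  also have "\<dots> = ennreal K * I"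
    unfolding I_def by (rule nn_integral_cmult) measurable
  finally have JL: "J + L \<le> ennreal (K * i)" using i K by (simp add: ennreal_mult)
  then have "J + L \<noteq> \<infinity>" by (auto simp: top_unique)
  then obtain j l where jl: "J = ennreal j" "0 \<le> j" "L = ennreal l" "0 \<le> l"
    by (cases J; cases L) auto
  have jl_le: "j + l \<le> K * i" using JL jl i K by (simp flip: ennreal_plus)
  have "j powr (1 / r) + l powr (1 / r) \<le> 2 powr (1 - 1 / r) * (j + l) powr (1 / r)"
    using jl r by (intro powr_add_le_concave) auto
  also have "\<dots> \<le> 2 powr (1 - 1 / r) * (K * i) powr (1 / r)"
    using jl_le jl r by (intro mult_left_mono powr_mono2) auto
  also have "\<dots> = 2 powr (1 - 1 / r) * K powr (1 / r) * i powr (1 / r)"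
    using K i by (simp add: powr_mult)
  finally show ?thesis
    unfolding norms i(1) jl(1) jl(3) r_def[symmetric] using i jl K
    by (simp add: ennreal_powr_ennreal flip: ennreal_plus ennreal_mult)
qed

text \<open>
  Disjointness of the supports makes the integrals of \<open>\<bar>Re x\<bar>\<^sup>r\<close> and \<open>\<bar>Im x\<bar>\<^sup>r\<close> add up to that of
  \<open>\<bar>x\<bar>\<^sup>r\<close>; equality of the norms makes them equal, so the integral of \<open>\<bar>x\<bar>\<^sup>r\<close> is twice the first.
\<close>
lemma Lp_norm_disjoint_Re_Im:
  fixes x :: "'a \<Rightarrow> complex"
  assumes p: "1 \<le> p" "p < \<infinity>" and x [measurable]: "x \<in> borel_measurable M"
    and eq: "Lp_norm M p (\<lambda>t. Re (x t)) = Lp_norm M p (\<lambda>t. Im (x t))"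
    and disj: "AE t in M. Re (x t) * Im (x t) = 0"
  shows "Lp_norm M p x = ennreal (2 powr (1 / enn2real p)) * Lp_norm M p (\<lambda>t. Re (x t))"
proof -
  define r where "r = enn2real p"
  have r: "1 \<le> r" unfolding r_def using p by (rule enn2real_ge_one)
  define J where "J = (\<integral>\<^sup>+t. ennreal (\<bar>Re (x t)\<bar> powr r) \<partial>M)"
  define L where "L = (\<integral>\<^sup>+t. ennreal (\<bar>Im (x t)\<bar> powr r) \<partial>M)"
  have "ennreal_powr J (1 / r) = ennreal_powr L (1 / r)"
    using eq p by (simp add: Lp_norm_finite_exponent J_def L_def r_def)
  then have "J = L" using r by (simp add: ennreal_powr_inject)
  have pointwise: "cmod z powr r = \<bar>Re z\<bar> powr r + \<bar>Im z\<bar> powr r" if "Re z * Im z = 0" for z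
    using that r by (auto simp: cmod_def)
  have "(\<integral>\<^sup>+t. ennreal (cmod (x t) powr r) \<partial>M)
      = (\<integral>\<^sup>+t. ennreal (\<bar>Re (x t)\<bar> powr r) + ennreal (\<bar>Im (x t)\<bar> powr r) \<partial>M)"
    using disj by (intro nn_integral_cong_AE) (auto simp: pointwise simp flip: ennreal_plus)
  also have "\<dots> = J + L"
    unfolding J_def L_def by (rule nn_integral_add) measurable
  also have "\<dots> = ennreal 2 * J"
    using \<open>J = L\<close> by (simp add: mult_2)
  finally show ?thesis
    using p ennreal_powr_cmult[of 2 J "1 / r"]
    by (simp add: Lp_norm_finite_exponent J_def r_def)
qed

section \<open>The essential supremum norm\<close>

lemma Lp_norm_infinity_Re_Im_le:
  fixes x :: "'a \<Rightarrow> complex"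
  assumes [measurable]: "x \<in> borel_measurable M"
  shows "Lp_norm M \<infinity> (\<lambda>t. Re (x t)) \<le> Lp_norm M \<infinity> x"
    and "Lp_norm M \<infinity> (\<lambda>t. Im (x t)) \<le> Lp_norm M \<infinity> x"
  unfolding Lp_norm_def
  by (auto intro!: esssup_mono ennreal_leI simp: abs_Re_le_cmod abs_Im_le_cmod)

lemma Lp_norm_infinity_disjoint_Re_Im:
  fixes x :: "'a \<Rightarrow> complex"
  assumes [measurable]: "x \<in> borel_measurable M"
    and disj: "AE t in M. Re (x t) * Im (x t) = 0"
  shows "Lp_norm M \<infinity> x = max (Lp_norm M \<infinity> (\<lambda>t. Re (x t))) (Lp_norm M \<infinity> (\<lambda>t. Im (x t)))"
proof (rule antisym)
  let ?A = "Lp_norm M \<infinity> (\<lambda>t. Re (x t))" and ?B = "Lp_norm M \<infinity> (\<lambda>t. Im (x t))"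
  have "AE t in M. ennreal \<bar>Re (x t)\<bar> \<le> ?A" "AE t in M. ennreal \<bar>Im (x t)\<bar> \<le> ?B"
    using esssup_AE[of "\<lambda>t. ennreal \<bar>Re (x t)\<bar>" M] esssup_AE[of "\<lambda>t. ennreal \<bar>Im (x t)\<bar>" M]
    by (simp_all add: Lp_norm_def)
  then have "AE t in M. ennreal (cmod (x t)) \<le> max ?A ?B"
    using disj by eventually_elim (auto simp: cmod_def le_max_iff_disj)
  then show "Lp_norm M \<infinity> x \<le> max ?A ?B"
    unfolding Lp_norm_def[of M \<infinity> x] by (simp add: esssup_I)
  show "max ?A ?B \<le> Lp_norm M \<infinity> x"
    using Lp_norm_infinity_Re_Im_le[of x M] by simp
qed

section \<open>The ratio of the norms\<close>

theorem proposition2p4: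
  fixes M :: "'a measure" and p :: ennreal and x :: "'a \<Rightarrow> complex"
  assumes p: "1 \<le> p"
    and x: "x \<in> Lp_complex M p"
    and nonzero: "\<not> (AE t in M. x t = 0)"
  defines "ratio \<equiv> (Lp_norm M p (\<lambda>t. Re (x t)) + Lp_norm M p (\<lambda>t. Im (x t))) / Lp_norm M p x"
  shows "(p \<le> 2 \<longrightarrow>
           ratio \<le> ennreal (sqrt 2) \<and>
           ((AE t in M. Re (x t) = Im (x t)) \<longrightarrow> ratio = ennreal (sqrt 2)))
       \<and> (2 \<le> p \<and> p < \<infinity> \<longrightarrow>
           ratio \<le> ennreal (2 powr (1 - 1 / enn2real p)) \<and>
           (Lp_norm M p (\<lambda>t. Re (x t)) = Lp_norm M p (\<lambda>t. Im (x t)) \<and>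
            (AE t in M. Re (x t) * Im (x t) = 0) \<longrightarrow>
              ratio = ennreal (2 powr (1 - 1 / enn2real p))))
       \<and> (p = \<infinity> \<longrightarrow>
           ratio \<le> 2 \<and>
           (Lp_norm M p (\<lambda>t. Re (x t)) = Lp_norm M p (\<lambda>t. Im (x t)) \<and>
            (AE t in M. Re (x t) * Im (x t) = 0) \<longrightarrow> ratio = 2))"
proof -
  define A where "A = Lp_norm M p (\<lambda>t. Re (x t))"
  define B where "B = Lp_norm M p (\<lambda>t. Im (x t))"
  define N where "N = Lp_norm M p x"
  have meas [measurable]: "x \<in> borel_measurable M" using x by (simp add: Lp_complex_def)
  have N_top: "N \<noteq> \<infinity>" using x by (simp add: N_def Lp_complex_def less_top)
  have N_0: "N \<noteq> 0" using Lp_norm_eq_0_imp_AE[OF p meas] nonzero by (auto simp: N_def)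
  have ratio: "ratio = (A + B) / N" by (simp add: ratio_def A_def B_def N_def)
  have ratio_le: "ratio \<le> c" if "A + B \<le> c * N" for c
    using divide_right_mono_ennreal[OF that, of N] mult_divide_eq_ennreal[of N c] N_0 N_top
    by (simp add: ratio)
  have ratio_eq: "ratio = c" if "A + B = c * N" for c
    using that mult_divide_eq_ennreal[of N c] N_0 N_top by (simp add: ratio)

  have small: "ratio \<le> ennreal (sqrt 2) \<and>
      ((AE t in M. Re (x t) = Im (x t)) \<longrightarrow> ratio = ennreal (sqrt 2))" if "p \<le> 2"
  proof -
    define r where "r = enn2real p"
    have fin: "p < \<infinity>" using that order_le_less_trans[of p 2 \<infinity>] by simp
    have r: "1 \<le> r" unfolding r_def using p fin by (rule enn2real_ge_one)
    have r2: "r \<le> 2" using enn2real_mono[OF that] by (simp add: r_def)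
    have "A + B \<le> ennreal (2 powr (1 - 1 / r) * (2 powr (1 - r / 2)) powr (1 / r)) * N"
      unfolding A_def B_def N_def r_def
      using r r2 by (intro Lp_norm_Re_Im_le[OF p fin x] abs_Re_Im_powr_le_concave)
        (auto simp: r_def)
    also have "2 powr (1 - 1 / r) * (2 powr (1 - r / 2)) powr (1 / r) = sqrt 2"
    proof -
      have "(1 - 1 / r) + (1 - r / 2) * (1 / r) = 1 / 2" using r by (simp add: field_simps)
      then show ?thesis by (simp only: powr_powr flip: powr_add) (simp add: powr_half_sqrt)
    qed
    finally have "ratio \<le> ennreal (sqrt 2)" by (rule ratio_le)
    moreover have "ratio = ennreal (sqrt 2)" if eq: "AE t in M. Re (x t) = Im (x t)"
    proof (rule ratio_eq)
      have "N = ennreal (sqrt 2) * A"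
        unfolding N_def A_def using eq
        by (intro Lp_norm_eq_cmult_if_AE[OF p fin])
          (auto elim!: eventually_mono simp: cmod_def real_sqrt_mult simp flip: mult_2)
      moreover have "B = ennreal 1 * A"
        unfolding B_def A_def using eq
        by (intro Lp_norm_eq_cmult_if_AE[OF p fin]) auto
      moreover have "ennreal (sqrt 2) * ennreal (sqrt 2) = 2"
        by (simp flip: ennreal_mult)
      ultimately show "A + B = ennreal (sqrt 2) * N"
        by (simp add: mult_2 flip: mult.assoc)
    qed
    ultimately show ?thesis by blast
  qed

  have large: "ratio \<le> ennreal (2 powr (1 - 1 / enn2real p)) \<and>
      (Lp_norm M p (\<lambda>t. Re (x t)) = Lp_norm M p (\<lambda>t. Im (x t)) \<and>
       (AE t in M. Re (x t) * Im (x t) = 0) \<longrightarrow>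
         ratio = ennreal (2 powr (1 - 1 / enn2real p)))" if "2 \<le> p" and fin: "p < \<infinity>"
  proof -
    define r where "r = enn2real p"
    have r2: "2 \<le> r" using enn2real_mono[OF \<open>2 \<le> p\<close>] fin by (simp add: r_def)
    have "A + B \<le> ennreal (2 powr (1 - 1 / r) * 1 powr (1 / r)) * N"
      unfolding A_def B_def N_def r_def
      using abs_Re_Im_powr_le_superadditive[OF r2]
      by (intro Lp_norm_Re_Im_le[OF p fin x]) (auto simp: r_def)
    then have "ratio \<le> ennreal (2 powr (1 - 1 / r))" using ratio_le by simp
    moreover have "ratio = ennreal (2 powr (1 - 1 / r))"
      if eq: "A = B" and disj: "AE t in M. Re (x t) * Im (x t) = 0"
    proof (rule ratio_eq)
      have "N = ennreal (2 powr (1 / r)) * A"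
        using Lp_norm_disjoint_Re_Im[OF p fin meas _ disj] eq
        by (simp add: N_def A_def B_def r_def)
      moreover have "ennreal (2 powr (1 - 1 / r)) * ennreal (2 powr (1 / r)) = 2"
        by (simp flip: ennreal_mult powr_add)
      ultimately show "A + B = ennreal (2 powr (1 - 1 / r)) * N"
        using eq by (simp add: mult_2 flip: mult.assoc)
    qed
    ultimately show ?thesis by (simp add: A_def B_def r_def)
  qed

  have infinite: "ratio \<le> 2 \<and>
      (Lp_norm M p (\<lambda>t. Re (x t)) = Lp_norm M p (\<lambda>t. Im (x t)) \<and>
       (AE t in M. Re (x t) * Im (x t) = 0) \<longrightarrow> ratio = 2)" if "p = \<infinity>"
  proof -
    have "A + B \<le> 2 * N"
      using Lp_norm_infinity_Re_Im_le[OF meas] that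
      by (simp add: A_def B_def N_def mult_2 add_mono)
    moreover have "A + B = 2 * N" if "A = B" "AE t in M. Re (x t) * Im (x t) = 0"
      using Lp_norm_infinity_disjoint_Re_Im[OF meas that(2)] that(1) \<open>p = \<infinity>\<close>
      by (simp add: A_def B_def N_def mult_2)
    ultimately show ?thesis using ratio_le ratio_eq by (simp add: A_def B_def)
  qed

  from small large infinite show ?thesis by blast
qed

end
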